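(* Let $G$ be a finite group. The order divisor graph $OD(G)$ is a star graph if and only if every non-identity element of $G$ has prime order.
   Context: For a finite group $G$, the order divisor graph $OD(G)$ is the simple undirected graph with vertex set $G$ in which two distinct vertices $a,b$ are adjacent if and only if $o(a)\neq o(b)$ and either $o(a)\mid o(b)$ or $o(b)\mid o(a)$ (here $o(x)$ is the order of $x$). A star graph is a tree having one vertex adjacent to all other vertices, all other vertices having degree $1$. *)

theory Defs
  imports "HOL-Computational_Algebra.Primes" "HOL-Algebra.Multiplicative_Group" "Graph_Theory.Graph_Theory"
begin

text \<open>A simple undirected graph is represented by a symmetric loop-free digraph without parallel
  arcs (locale \<open>pair_graph\<close>): an edge \<open>{a, b}\<close> is the pair of arcs \<open>(a, b)\<close> and \<open>(b, a)\<close>.\<close>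

definition order_divisor_graph :: "('a, 'b) monoid_scheme \<Rightarrow> 'a pair_pre_digraph" where
  "order_divisor_graph G =
     \<lparr> pverts = carrier G,
       parcs = {(a, b). a \<in> carrier G \<and> b \<in> carrier G \<and> a \<noteq> b \<and>
                        group.ord G a \<noteq> group.ord G b \<and>
                        (group.ord G a dvd group.ord G b \<or> group.ord G b dvd group.ord G a)} \<rparr>"

lemma pair_graph_order_divisor_graph:
  assumes "finite (carrier G)"
  shows "pair_graph (order_divisor_graph G)"
proof -
  have "finite (parcs (order_divisor_graph G))"
    by (rule finite_subset[OF _ finite_cartesian_product[OF assms assms]])
       (auto simp: order_divisor_graph_def)
  with assms show ?thesis
    by unfold_locales (auto simp: order_divisor_graph_def symmetric_def intro!: symI)
qed

text \<open>The constant \<open>tree\<close> of \<open>Graph_Theory\<close> is not usable for this representation: it also excludes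
  the directed cycle \<open>a, b, a\<close>, which every edge \<open>{a, b}\<close> gives rise to. The cycles of the
  undirected graph are the directed cycles of length at least 3.\<close>

definition undirected_tree :: "'a pair_pre_digraph \<Rightarrow> bool" where
  "undirected_tree H \<longleftrightarrow>
     pair_graph H \<and> Digraph_Component.connected (with_proj H) \<and>
     \<not> (\<exists>p. pre_digraph.cycle (with_proj H) p \<and> 3 \<le> length p)"

text \<open>By symmetry the degree of a vertex is its out-degree. The graph with a single vertex counts as
  a star; this is the case of the trivial group.\<close>

definition star_graph :: "'a pair_pre_digraph \<Rightarrow> bool" where
  "star_graph H \<longleftrightarrow>
     undirected_tree H \<and>
     (\<exists>c \<in> pverts H. \<forall>v \<in> pverts H - {c}. (c, v) \<in> parcs H \<and> out_degree (with_proj H) v = 1)"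

end

theory Submission
  imports Defs
begin

text \<open>The identity is adjacent to every other vertex. If \<open>o(x)\<close> has a prime factor
  \<open>p \<noteq> o(x)\<close>, then a power \<open>y\<close> of \<open>x\<close> has order \<open>p\<close>, and
  \<open>x\<close>, \<open>y\<close>, \<open>\<one>\<close> form a triangle, which a star does not contain. Conversely, two non-identity
  elements of prime order are never adjacent, so the identity is the centre of a star.\<close>

text \<open>Only the centre can have two distinct out-neighbours, since every other vertex has
  out-degree 1. In a triangle both \<open>x\<close> and \<open>y\<close> have two, so both would be
  the centre.\<close>

lemma star_graph_no_triangle:
  assumes star: "star_graph H"
    and xy: "(x, y) \<in> parcs H" "(y, x) \<in> parcs H"
    and xz: "(x, z) \<in> parcs H" and yz: "(y, z) \<in> parcs H"
  shows False
proof -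
  from star interpret pair_graph H
    by (simp add: star_graph_def undirected_tree_def)
  from star obtain c where c: "\<And>v. v \<in> pverts H - {c} \<Longrightarrow> out_degree (with_proj H) v = 1"
    unfolding star_graph_def by blast
  have centre: "v = c"
    if v: "(v, a) \<in> parcs H" "(v, b) \<in> parcs H" and "a \<noteq> b" for v a b
  proof (rule ccontr)
    assume "v \<noteq> c"
    with c v have "out_degree (with_proj H) v = 1"
      using arc_fst_in_verts by fastforce
    then obtain e where "out_arcs (with_proj H) v = {e}"
      unfolding out_degree_def by (auto simp: card_1_singleton_iff)
    moreover have "{(v, a), (v, b)} \<subseteq> out_arcs (with_proj H) v"
      using v by (auto simp: out_arcs_def)
    ultimately show False using \<open>a \<noteq> b\<close> by auto
  qed
  have ne: "x \<noteq> y" "y \<noteq> z" "x \<noteq> z"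
    using pair_no_loops[OF xy(1)] pair_no_loops[OF yz] pair_no_loops[OF xz] by simp_all
  have "x = c" using centre[OF xy(1) xz] ne by simp
  moreover have "y = c" using centre[OF xy(2) yz] ne by simp
  ultimately show False using ne by simp
qed

text \<open>Any two vertices are joined through \<open>c\<close>. Since each arc contains
  \<open>c\<close>, any other vertex has \<open>c\<close> as its only neighbour, and three
  consecutive arcs of a cycle of length at least 3 would all share \<open>c\<close>, which is
  impossible.\<close>

lemma star_graphI:
  assumes "pair_graph H" and c: "c \<in> pverts H"
    and adj: "\<And>v. v \<in> pverts H - {c} \<Longrightarrow> (c, v) \<in> parcs H"
    and inc: "\<And>u v. (u, v) \<in> parcs H \<Longrightarrow> u = c \<or> v = c"
  shows "star_graph H"
proof -
  interpret pair_graph H by fact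
  have adj': "(v, c) \<in> parcs H" if "v \<in> pverts H - {c}" for v
    using adj[OF that] arcs_symmetric by blast
  have "u \<rightarrow>\<^sup>*\<^bsub>with_proj H\<^esub> v" if "u \<in> pverts H" "v \<in> pverts H" for u v
  proof -
    have "u \<rightarrow>\<^sup>*\<^bsub>with_proj H\<^esub> c"
      using adj'[of u] that c by (cases "u = c") auto
    also have "c \<rightarrow>\<^sup>*\<^bsub>with_proj H\<^esub> v"
      using adj[of v] that c by (cases "v = c") auto
    finally show ?thesis .
  qed
  \<comment> \<open>\<open>connected\<close> means strong connectivity of the symmetric closure,
    which inherits the paths through \<open>c\<close>.\<close>
  then have conn: "Digraph_Component.connected (with_proj H)"
    using c unfolding connected_def strongly_connected_def
    by (auto intro!: reachable_mk_symmetricI)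
  have acyc: False if cyc: "cycle p" and len: "3 \<le> length p" for p
  proof -
    from len obtain e1 e2 e3 q where p: "p = e1 # e2 # e3 # q"
      by (auto simp: numeral_3_eq_3 Suc_le_length_iff)
    from cyc obtain u where u: "awalk u p u" and d: "distinct (tl (pawalk_verts u p))"
      unfolding cycle_def by auto
    from u p have arcs: "e1 \<in> parcs H" "e2 \<in> parcs H" "e3 \<in> parcs H"
      and walk: "fst e1 = u" "fst e2 = snd e1" "fst e3 = snd e2" "pcas (snd e3) q u"
      unfolding awalk_def by auto
    \<comment> \<open>The list in \<open>d\<close> is \<open>fst e2\<close>, \<open>fst e3\<close>
      followed by the vertices of \<open>q\<close>. These contain both ends of \<open>q\<close>,
      namely \<open>snd e3\<close> and the return to \<open>u\<close>, so distinctness yields the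
      three inequalities. By them \<open>c\<close> on \<open>e2\<close> misses \<open>e3\<close> if
      it is \<open>fst e2\<close>, and misses \<open>e1\<close> if it is
      \<open>fst e3\<close>.\<close>
    have "pcas w r v \<Longrightarrow> w \<in> set (pawalk_verts w r) \<and> v \<in> set (pawalk_verts w r)" for w r v
      by (induction r arbitrary: w) auto
    from this[OF walk(4)] d p have "snd e3 \<noteq> fst e2" "u \<noteq> fst e3" "fst e2 \<noteq> fst e3"
      by auto
    moreover have "fst e = c \<or> snd e = c" if "e \<in> parcs H" for e
      using inc[of "fst e" "snd e"] that by simp
    ultimately show False using arcs walk by metis
  qed
  have deg: "out_degree (with_proj H) v = 1" if v: "v \<in> pverts H - {c}" for v
  proof -
    have "out_arcs (with_proj H) v = {(v, c)}"
      using v adj'[OF v] by (auto simp: out_arcs_def dest: inc)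
    then show ?thesis by (simp add: out_degree_def)
  qed
  show ?thesis
    unfolding star_graph_def undirected_tree_def
    using \<open>pair_graph H\<close> conn acyc
    by (intro conjI bexI[of _ c] ballI c) (auto simp: adj deg)
qed

theorem theorem1:
  fixes G (structure)
  assumes "group G" and "finite (carrier G)"
  shows "star_graph (order_divisor_graph G) \<longleftrightarrow>
         (\<forall>x \<in> carrier G - {\<one>}. Factorial_Ring.prime (group.ord G x))"
proof -
  interpret group G by fact
  let ?H = "order_divisor_graph G"
  have arc_iff: "(a, b) \<in> parcs ?H \<longleftrightarrow> a \<in> carrier G \<and> b \<in> carrier G \<and>
      ord a \<noteq> ord b \<and> (ord a dvd ord b \<or> ord b dvd ord a)" for a b
    by (auto simp: order_divisor_graph_def)
  show ?thesis
  proof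
    assume star: "star_graph ?H"
    show "\<forall>x \<in> carrier G - {\<one>}. Factorial_Ring.prime (ord x)"
    proof (rule ballI, rule ccontr)
      fix x assume x: "x \<in> carrier G - {\<one>}" and np: "\<not> Factorial_Ring.prime (ord x)"
      have x1: "ord x \<noteq> 1" and x0: "ord x > 0"
        using x ord_eq_1 ord_ge_1[OF assms(2), of x] by auto
      obtain p m where p: "Factorial_Ring.prime p" and m: "ord x = p * m"
        using prime_factor_nat[OF x1] by auto
      \<comment> \<open>As \<open>m\<close> divides the order of \<open>x\<close>, this power has
        order \<open>ord x div m\<close>, that is \<open>p\<close>.\<close>
      define y where "y = x [^] m"
      have y: "y \<in> carrier G" "ord y = p"
        unfolding y_def using x x0 m ord_pow[of x m] by auto
      \<comment> \<open>The orders \<open>1\<close>, \<open>p\<close> and \<open>ord x\<close> are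
        thus pairwise distinct, and each divides the next.\<close>
      have "p \<noteq> ord x" "p \<noteq> 1" using p np by auto
      then show False
        using star_graph_no_triangle[OF star, of x y \<one>] x x1 y m
        by (simp add: arc_iff)
    qed
  next
    assume prime: "\<forall>x \<in> carrier G - {\<one>}. Factorial_Ring.prime (ord x)"
    show "star_graph ?H"
    proof (rule star_graphI)
      show "pair_graph ?H" using assms(2) by (rule pair_graph_order_divisor_graph)
      show "\<one> \<in> pverts ?H" by (simp add: order_divisor_graph_def)
      show "(\<one>, v) \<in> parcs ?H" if "v \<in> pverts ?H - {\<one>}" for v
      proof -
        have "v \<in> carrier G" "v \<noteq> \<one>" using that by (auto simp: order_divisor_graph_def)
        then show ?thesis using ord_eq_1[of v] by (simp add: arc_iff)
      qed
      show "u = \<one> \<or> v = \<one>" if "(u, v) \<in> parcs ?H" for u v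
      proof (rule ccontr)
        assume "\<not> (u = \<one> \<or> v = \<one>)"
        then have "Factorial_Ring.prime (ord u)" "Factorial_Ring.prime (ord v)"
          using that prime by (simp_all add: arc_iff)
        \<comment> \<open>Divisibility in either direction makes two primes equal, whereas an arc
          needs different orders.\<close>
        then show False
          using that primes_dvd_imp_eq[of "ord u" "ord v"] primes_dvd_imp_eq[of "ord v" "ord u"]
          unfolding arc_iff by metis
      qed
    qed
  qed
qed

end
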